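(* Let $V>0$ and let $\alpha>0$ be fixed. Let $(\beta(t),\nu(t))$ be the solution of the system $$\dot\beta=-\mathbb E\left[\tfrac{\partial K}{\partial\beta}\right],\qquad \dot\nu=-\mathbb E\left[\tfrac{\partial K}{\partial\nu}\right]$$ (right-hand sides given in the context) with initial values $\beta(0),\nu(0)$. Then for any $\beta(0),\nu(0)>0$ we have $$\tilde V_{\rm est}(t):=\frac{\beta(t)(\nu(t)+1)}{(\alpha-A(\alpha))\nu(t)}\to V\qquad\text{as }t\to\infty.$$
   Context: The right-hand sides are, for $\beta,\nu>0$ and with $\sigma=\beta(\nu+1)/\nu$, $$\mathbb E\left[\tfrac{\partial K}{\partial\beta}\right]=\frac1\beta\left(\frac{\alpha+1/2}{(2\pi)^{1/2}}\int_{-\infty}^\infty\frac{1}{1+\frac V\sigma\frac{z^2}2}e^{-z^2/2}dz-\alpha\right),$$ $$\mathbb E\left[\tfrac{\partial K}{\partial\nu}\right]=\frac1{2\nu(\nu+1)}\left(\frac{2\alpha+1}{(2\pi)^{1/2}}\int_{-\infty}^\infty\frac{z^2}{\frac{2\sigma}{V}+z^2}e^{-z^2/2}dz-1\right).$$ For $x>0$ let $F(x)=\frac1{(2\pi)^{1/2}}\int_{-\infty}^\infty\frac1{2x+z^2}e^{-z^2/2}dz$. For $\alpha>0$, $A=A(\alpha)<\alpha$ is the unique root of $F(\alpha-A)=\frac{\alpha}{(2\alpha+1)(\alpha-A)}$. ($V$ is the variance of the ground truth normal distribution.) *)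

theory Defs
  imports "HOL-Analysis.Analysis"
begin

definition sigma :: "real \<Rightarrow> real \<Rightarrow> real" where
  "sigma \<beta> \<nu> = \<beta> * (\<nu> + 1) / \<nu>"

text \<open>
  The expected partial derivatives of \<open>K\<close>, given by their closed forms.  They are meaningful
  for positive \<open>V\<close>, \<open>\<beta>\<close> and \<open>\<nu>\<close>, in which case both integrands are a bounded function times
  a Gaussian, hence integrable.
\<close>

definition EdK_dbeta :: "real \<Rightarrow> real \<Rightarrow> real \<Rightarrow> real \<Rightarrow> real" where
  "EdK_dbeta V \<alpha> \<beta> \<nu> =
     1 / \<beta> * ((\<alpha> + 1/2) / sqrt (2 * pi) *
       (LBINT z. 1 / (1 + V / sigma \<beta> \<nu> * (z\<^sup>2 / 2)) * exp (- z\<^sup>2 / 2)) - \<alpha>)"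

definition EdK_dnu :: "real \<Rightarrow> real \<Rightarrow> real \<Rightarrow> real \<Rightarrow> real" where
  "EdK_dnu V \<alpha> \<beta> \<nu> =
     1 / (2 * \<nu> * (\<nu> + 1)) * ((2 * \<alpha> + 1) / sqrt (2 * pi) *
       (LBINT z. z\<^sup>2 / (2 * sigma \<beta> \<nu> / V + z\<^sup>2) * exp (- z\<^sup>2 / 2)) - 1)"

definition F :: "real \<Rightarrow> real" where
  "F x = 1 / sqrt (2 * pi) * (LBINT z. 1 / (2 * x + z\<^sup>2) * exp (- z\<^sup>2 / 2))"

definition A :: "real \<Rightarrow> real" where
  "A \<alpha> = (THE a. a < \<alpha> \<and> F (\<alpha> - a) = \<alpha> / ((2 * \<alpha> + 1) * (\<alpha> - a)))"

text \<open>
  Solutions of the gradient flow on \<open>[0, \<infinity>)\<close>; the derivative at \<open>0\<close> is one-sided.  Positivity is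
  required only of the initial values: on the open quadrant the flow conserves
  \<open>\<beta>\<^sup>2/2 + \<nu>\<^sup>3/3 + \<nu>\<^sup>2/2\<close> and is repelled from both axes, so solutions starting there never
  reach arguments at which the right-hand sides are not meaningful.
\<close>

definition flow_solution ::
    "real \<Rightarrow> real \<Rightarrow> (real \<Rightarrow> real) \<Rightarrow> (real \<Rightarrow> real) \<Rightarrow> bool" where
  "flow_solution V \<alpha> \<beta> \<nu> \<longleftrightarrow>
     (\<forall>t\<ge>0. (\<beta> has_real_derivative - EdK_dbeta V \<alpha> (\<beta> t) (\<nu> t)) (at t within {0..}) \<and>
            (\<nu> has_real_derivative - EdK_dnu V \<alpha> (\<beta> t) (\<nu> t)) (at t within {0..}))"

definition V_est :: "real \<Rightarrow> real \<Rightarrow> real \<Rightarrow> real" where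
  "V_est \<alpha> \<beta> \<nu> = \<beta> * (\<nu> + 1) / ((\<alpha> - A \<alpha>) * \<nu>)"

end

theory Submission
  imports Defs "HOL-Probability.Distributions"
begin

text \<open>
  Let \<open>z\<close> be standard normal.  Both right-hand sides are governed by one number, the mean \<open>G x\<close>
  of \<open>2 * x / (2 * x + z\<^sup>2)\<close> at \<open>x = sigma \<beta> \<nu> / V\<close> (called \<open>gauss_ratio\<close> below): with
  \<open>h = (\<alpha> + 1/2) * G x - \<alpha>\<close> the flow reads
  \<open>\<beta>' = - h / \<beta>\<close> and \<open>\<nu>' = h / (\<nu> * (\<nu> + 1))\<close>.  Since \<open>G\<close> increases strictly and continuously
  from \<open>0\<close> to \<open>1\<close>, the factor \<open>h\<close> has exactly one zero \<open>x > 0\<close>.  As \<open>G x = 2 * x * F x\<close>, the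
  equation defining \<open>A \<alpha>\<close> says that this zero is \<open>\<alpha> - A \<alpha>\<close>.  So the claim is that
  \<open>sigma \<beta> \<nu>\<close> tends to \<open>r = V * (\<alpha> - A \<alpha>)\<close>, the point at which \<open>h\<close> changes sign.

  Two quantities show this.  The energy \<open>\<beta>\<^sup>2 / 2 + \<nu>\<^sup>3 / 3 + \<nu>\<^sup>2 / 2\<close> is conserved, because the
  two contributions \<open>\<beta> * \<beta>' = - h\<close> and \<open>(\<nu>\<^sup>2 + \<nu>) * \<nu>' = h\<close> cancel.  And the logarithmic
  deviation \<open>u = ln (sigma \<beta> \<nu> / r)\<close> satisfies
  \<open>u' = - h * (1 / \<beta>\<^sup>2 + 1 / (\<nu> * (\<nu> + 1))\<^sup>2)\<close>,
  where \<open>h\<close> has the sign of \<open>u\<close>, so that \<open>u\<^sup>2\<close> decreases.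

  A bound on \<open>u\<close> confines the solution to a cone \<open>m * \<nu> \<le> \<beta> * (\<nu> + 1) \<le> M * \<nu>\<close> with
  \<open>m, M > 0\<close>, which meets the boundary of the quadrant only at the origin; there the energy
  vanishes.  Hence the solution stays in the open quadrant forever (\<open>positive\<close>).  By the energy,
  \<open>\<beta>\<close> is bounded, so \<open>1 / \<beta>\<^sup>2\<close> is bounded below and \<open>u\<^sup>2\<close> decreases at a uniform rate while
  \<open>u\<close> is away from \<open>0\<close>; being nonnegative, it must become small and then stays so
  (\<open>dev_tendsto_0\<close>).
\<close>

section \<open>The Gaussian mean of a saturating ratio\<close>

definition gauss_ratio :: "real \<Rightarrow> real" where
  "gauss_ratio x = (LBINT z. 2 * x / (2 * x + z\<^sup>2) * std_normal_density z)"

lemma ratio_bounds: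
  fixes x z :: real
  assumes "x > 0"
  shows "0 \<le> 2 * x / (2 * x + z\<^sup>2)" "2 * x / (2 * x + z\<^sup>2) \<le> 1"
proof -
  have "2 * x + z\<^sup>2 > 0" using assms by (simp add: add_pos_nonneg)
  then show "0 \<le> 2 * x / (2 * x + z\<^sup>2)" "2 * x / (2 * x + z\<^sup>2) \<le> 1"
    using assms by (auto simp: divide_le_eq)
qed

lemma gauss_integrand_bound:
  assumes "x > 0"
  shows "norm (2 * x / (2 * x + z\<^sup>2) * std_normal_density z) \<le> std_normal_density z"
proof -
  have "norm (2 * x / (2 * x + z\<^sup>2) * std_normal_density z)
      = 2 * x / (2 * x + z\<^sup>2) * std_normal_density z"
    unfolding real_norm_def
    using ratio_bounds(1)[OF assms, of z] by (intro abs_of_nonneg mult_nonneg_nonneg) auto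
  also have "\<dots> \<le> std_normal_density z"
    using ratio_bounds[OF assms, of z] by (intro mult_left_le_one_le) auto
  finally show ?thesis .
qed

lemma integrable_gauss_ratio:
  assumes "x > 0"
  shows "integrable lborel (\<lambda>z. 2 * x / (2 * x + z\<^sup>2) * std_normal_density z)"
proof (rule Bochner_Integration.integrable_bound[of lborel std_normal_density])
  show "integrable lborel std_normal_density" by simp
  show "AE z in lborel. norm (2 * x / (2 * x + z\<^sup>2) * std_normal_density z)
          \<le> norm (std_normal_density z)"
    using gauss_integrand_bound[OF assms] by (intro AE_I2) (metis order_trans abs_ge_self real_norm_def)
qed simp

text \<open>
  The integrand increases strictly in \<open>x\<close> except at \<open>z = 0\<close>, where it does not depend on \<open>x\<close>;
  so the difference of two integrands is positive almost everywhere, and such a function cannot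
  have integral \<open>0\<close>.
\<close>

lemma gauss_ratio_strict_mono: "strict_mono_on {0<..} gauss_ratio"
proof (rule strict_mono_onI)
  fix x y :: real
  assume "x \<in> {0<..}" "y \<in> {0<..}" and xy: "x < y"
  then have x: "x > 0" and y: "y > 0" by auto
  let ?f = "\<lambda>x z. 2 * x / (2 * x + z\<^sup>2) * std_normal_density z"
  let ?d = "\<lambda>z. ?f y z - ?f x z"
  have less: "?f x z < ?f y z" if "z \<noteq> 0" for z
  proof -
    have z: "z\<^sup>2 > 0" using that by simp
    have "2 * x + z\<^sup>2 > 0" "2 * y + z\<^sup>2 > 0"
      using x y by (simp_all add: add_pos_nonneg)
    then have "2 * x / (2 * x + z\<^sup>2) < 2 * y / (2 * y + z\<^sup>2)"
      using xy z by (simp add: divide_simps) (simp add: algebra_simps)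
    then show ?thesis by (intro mult_strict_right_mono normal_density_pos) auto
  qed
  have AE_nz: "AE z in lborel. z \<noteq> (0::real)" by (rule AE_lborel_singleton)
  have int: "integrable lborel ?d"
    using x y by (intro Bochner_Integration.integrable_diff integrable_gauss_ratio)
  have nonneg: "AE z in lborel. 0 \<le> ?d z"
    using AE_nz by eventually_elim (use less in \<open>simp add: less_imp_le\<close>)
  have "integral\<^sup>L lborel ?d \<noteq> 0"
  proof
    assume "integral\<^sup>L lborel ?d = 0"
    then have "AE z in lborel. ?d z = 0"
      using integral_nonneg_eq_0_iff_AE[OF int nonneg] by blast
    with AE_nz have "AE z::real in lborel. False"
      by eventually_elim (use less in fastforce)
    then show False by (simp add: eventually_False ae_filter_eq_bot_iff)
  qed
  moreover have "integral\<^sup>L lborel ?d \<ge> 0" using nonneg by (rule integral_nonneg_AE)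
  moreover have "integral\<^sup>L lborel ?d = gauss_ratio y - gauss_ratio x"
    unfolding gauss_ratio_def
    using x y by (intro Bochner_Integration.integral_diff integrable_gauss_ratio)
  ultimately show "gauss_ratio x < gauss_ratio y" by simp
qed

text \<open>
  Dominated convergence with the Gaussian density as majorant.  Pointwise limits are asked for
  only at \<open>z \<noteq> 0\<close>, because for \<open>X n \<longlonglongrightarrow> 0\<close> the ratio is constantly \<open>1\<close> at \<open>z = 0\<close> while it
  tends to \<open>0\<close> elsewhere.
\<close>

lemma gauss_ratio_dominated:
  assumes X: "\<And>n::nat. X n > 0"
    and lim: "\<And>z. z \<noteq> 0 \<Longrightarrow> (\<lambda>n. 2 * X n / (2 * X n + z\<^sup>2)) \<longlonglongrightarrow> g z"
    and g[measurable]: "g \<in> borel_measurable borel"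
  shows "(\<lambda>n. gauss_ratio (X n)) \<longlonglongrightarrow> (LBINT z. g z * std_normal_density z)"
  unfolding gauss_ratio_def
proof (rule integral_dominated_convergence[where w = std_normal_density])
  have "AE z in lborel. z \<noteq> (0::real)" by (rule AE_lborel_singleton)
  then show "AE z in lborel. (\<lambda>n. 2 * X n / (2 * X n + z\<^sup>2) * std_normal_density z)
        \<longlonglongrightarrow> g z * std_normal_density z"
    by eventually_elim (intro tendsto_mult tendsto_const lim)
  show "AE z in lborel. norm (2 * X n / (2 * X n + z\<^sup>2) * std_normal_density z)
      \<le> std_normal_density z" for n
    using gauss_integrand_bound[OF X[of n]] by (intro AE_I2)
qed simp_all

lemma gauss_ratio_continuous: "continuous_on {0<..} gauss_ratio"
proof (rule continuous_on_sequentiallyI)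
  fix X :: "nat \<Rightarrow> real" and a
  assume X: "\<forall>n. X n \<in> {0<..}" and a: "a \<in> {0<..}" and lim: "X \<longlonglongrightarrow> a"
  show "(\<lambda>n. gauss_ratio (X n)) \<longlonglongrightarrow> gauss_ratio a"
    unfolding gauss_ratio_def[of a]
  proof (rule gauss_ratio_dominated)
    fix z :: real
    have "2 * a + z\<^sup>2 \<noteq> 0" using a by (simp add: add_pos_nonneg less_imp_neq[symmetric])
    then show "(\<lambda>n. 2 * X n / (2 * X n + z\<^sup>2)) \<longlonglongrightarrow> 2 * a / (2 * a + z\<^sup>2)"
      by (intro tendsto_intros lim)
  qed (use X in auto)
qed

text \<open>
  The mean tends to \<open>0\<close> along \<open>1 / n\<close> and to \<open>1\<close> along \<open>n\<close>, so the intermediate value theorem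
  applies.
\<close>

lemma gauss_ratio_attains:
  assumes "0 < c" "c < 1"
  obtains x where "x > 0" "gauss_ratio x = c"
proof -
  have lim: "(\<lambda>n. 1 / real (Suc n)) \<longlonglongrightarrow> 0"
    using LIMSEQ_inverse_real_of_nat by (simp add: inverse_eq_divide)
  have "(\<lambda>n. gauss_ratio (1 / real (Suc n))) \<longlonglongrightarrow> (LBINT z. 0 * std_normal_density z)"
  proof (rule gauss_ratio_dominated)
    fix z :: real assume "z \<noteq> 0"
    then have "(\<lambda>n. 2 * (1 / real (Suc n)) / (2 * (1 / real (Suc n)) + z\<^sup>2))
        \<longlonglongrightarrow> 2 * 0 / (2 * 0 + z\<^sup>2)"
      by (intro tendsto_intros lim) auto
    then show "(\<lambda>n. 2 * (1 / real (Suc n)) / (2 * (1 / real (Suc n)) + z\<^sup>2)) \<longlonglongrightarrow> 0"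
      by simp
  qed auto
  then have "(\<lambda>n. gauss_ratio (1 / real (Suc n))) \<longlonglongrightarrow> 0" by simp
  then have "eventually (\<lambda>n. gauss_ratio (1 / real (Suc n)) < c) sequentially"
    using assms(1) by (rule order_tendstoD)
  then obtain m where m: "gauss_ratio (1 / real (Suc m)) < c"
    by (meson eventually_sequentially order_refl)
  have "(\<lambda>n. gauss_ratio (real (Suc n))) \<longlonglongrightarrow> (LBINT z. 1 * std_normal_density z)"
  proof (rule gauss_ratio_dominated)
    fix z :: real
    have "(\<lambda>n. 2 / (2 + z\<^sup>2 * (1 / real (Suc n)))) \<longlonglongrightarrow> 2 / (2 + z\<^sup>2 * 0)"
      by (intro tendsto_intros lim) auto
    moreover have "2 / (2 + z\<^sup>2 * (1 / y)) = 2 * y / (2 * y + z\<^sup>2)" if "y > 0" for y :: real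
      using that by (simp add: divide_simps)
    ultimately show "(\<lambda>n. 2 * real (Suc n) / (2 * real (Suc n) + z\<^sup>2)) \<longlonglongrightarrow> 1"
      by simp
  qed auto
  then have "(\<lambda>n. gauss_ratio (real (Suc n))) \<longlonglongrightarrow> 1" by simp
  then have "eventually (\<lambda>n. gauss_ratio (real (Suc n)) > c) sequentially"
    using assms(2) by (rule order_tendstoD)
  then obtain n where n: "gauss_ratio (real (Suc n)) > c"
    by (meson eventually_sequentially order_refl)
  have "1 / real (Suc m) \<le> real (Suc n)"
    by (rule order_trans[of _ 1]) (simp_all add: divide_le_eq)
  moreover have "continuous_on {1 / real (Suc m)..real (Suc n)} gauss_ratio"
    by (rule continuous_on_subset[OF gauss_ratio_continuous])
       (auto intro: less_le_trans[of 0 "1 / real (Suc m)"])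
  ultimately obtain x where x: "1 / real (Suc m) \<le> x" "gauss_ratio x = c"
    using IVT'[of gauss_ratio "1 / real (Suc m)" c "real (Suc n)"] m n by auto
  moreover have "0 < 1 / real (Suc m)" by simp
  ultimately show ?thesis using that[of x] by linarith
qed

section \<open>The right-hand sides in terms of the ratio\<close>

lemma F_eq_gauss_ratio:
  assumes "x > 0"
  shows "F x = gauss_ratio x / (2 * x)"
proof -
  have "gauss_ratio x = (LBINT z. (2 * x / sqrt (2 * pi)) * (1 / (2 * x + z\<^sup>2) * exp (- z\<^sup>2 / 2)))"
    unfolding gauss_ratio_def std_normal_density_def
    by (intro Bochner_Integration.integral_cong) auto
  also have "\<dots> = (2 * x / sqrt (2 * pi)) * (LBINT z. 1 / (2 * x + z\<^sup>2) * exp (- z\<^sup>2 / 2))"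
    by (rule integral_mult_right_zero)
  also have "\<dots> = 2 * x * F x"
    unfolding F_def by simp
  finally show ?thesis using assms by simp
qed

lemma EdK_dbeta_eq:
  assumes V: "V > 0" and s: "sigma \<beta> \<nu> > 0"
  shows "EdK_dbeta V \<alpha> \<beta> \<nu> = ((\<alpha> + 1/2) * gauss_ratio (sigma \<beta> \<nu> / V) - \<alpha>) / \<beta>"
proof -
  let ?x = "sigma \<beta> \<nu> / V"
  have "gauss_ratio ?x =
      (LBINT z. (1 / sqrt (2 * pi)) * (1 / (1 + V / sigma \<beta> \<nu> * (z\<^sup>2 / 2)) * exp (- z\<^sup>2 / 2)))"
    unfolding gauss_ratio_def std_normal_density_def
  proof (intro Bochner_Integration.integral_cong refl)
    fix z :: real
    have "2 * ?x + z\<^sup>2 > 0" "1 + V / sigma \<beta> \<nu> * (z\<^sup>2 / 2) > 0"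
      using V s by (intro add_pos_nonneg; simp)+
    then have "2 * ?x / (2 * ?x + z\<^sup>2) = 1 / (1 + V / sigma \<beta> \<nu> * (z\<^sup>2 / 2))"
      using V s by (simp add: field_simps)
    then show "2 * ?x / (2 * ?x + z\<^sup>2) * (1 / sqrt (2 * pi) * exp (- z\<^sup>2 / 2)) =
        (1 / sqrt (2 * pi)) * (1 / (1 + V / sigma \<beta> \<nu> * (z\<^sup>2 / 2)) * exp (- z\<^sup>2 / 2))"
      by simp
  qed
  also have "\<dots> = 1 / sqrt (2 * pi) *
      (LBINT z. 1 / (1 + V / sigma \<beta> \<nu> * (z\<^sup>2 / 2)) * exp (- z\<^sup>2 / 2))"
    by (rule integral_mult_right_zero)
  finally show ?thesis unfolding EdK_dbeta_def by simp
qed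

text \<open>
  The integrand of the second right-hand side is one minus the saturating ratio, which is why
  the same factor appears here with the opposite sign.
\<close>

lemma EdK_dnu_eq:
  assumes V: "V > 0" and s: "sigma \<beta> \<nu> > 0"
  shows "EdK_dnu V \<alpha> \<beta> \<nu> = - ((\<alpha> + 1/2) * gauss_ratio (sigma \<beta> \<nu> / V) - \<alpha>) / (\<nu> * (\<nu> + 1))"
proof -
  let ?x = "sigma \<beta> \<nu> / V"
  have x: "?x > 0" using V s by simp
  have "1 - gauss_ratio ?x =
      (LBINT z. std_normal_density z - 2 * ?x / (2 * ?x + z\<^sup>2) * std_normal_density z)"
    unfolding gauss_ratio_def
    by (subst Bochner_Integration.integral_diff) (simp_all only: integrable_gauss_ratio[OF x]
        integrable_normal_density integral_normal_density zero_less_one)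
  also have "\<dots> =
      (LBINT z. (1 / sqrt (2 * pi)) * (z\<^sup>2 / (2 * sigma \<beta> \<nu> / V + z\<^sup>2) * exp (- z\<^sup>2 / 2)))"
  proof (intro Bochner_Integration.integral_cong refl)
    fix z :: real
    have "2 * ?x + z\<^sup>2 \<noteq> 0" using add_pos_nonneg[of "2 * ?x" "z\<^sup>2"] x by simp
    then have "1 - y / (y + z\<^sup>2) = z\<^sup>2 / (y + z\<^sup>2)" if "y = 2 * ?x" for y
      unfolding that[symmetric] by (simp add: diff_divide_eq_iff)
    then have "1 - 2 * ?x / (2 * ?x + z\<^sup>2) = z\<^sup>2 / (2 * ?x + z\<^sup>2)" by blast
    then have "std_normal_density z - 2 * ?x / (2 * ?x + z\<^sup>2) * std_normal_density z
        = z\<^sup>2 / (2 * ?x + z\<^sup>2) * std_normal_density z"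
      by (metis left_diff_distrib mult_1)
    then show "std_normal_density z - 2 * ?x / (2 * ?x + z\<^sup>2) * std_normal_density z =
        (1 / sqrt (2 * pi)) * (z\<^sup>2 / (2 * sigma \<beta> \<nu> / V + z\<^sup>2) * exp (- z\<^sup>2 / 2))"
      unfolding std_normal_density_def by simp
  qed
  also have "\<dots> =
      1 / sqrt (2 * pi) * (LBINT z. z\<^sup>2 / (2 * sigma \<beta> \<nu> / V + z\<^sup>2) * exp (- z\<^sup>2 / 2))"
    by (rule integral_mult_right_zero)
  finally have I: "1 / sqrt (2 * pi) * (LBINT z. z\<^sup>2 / (2 * sigma \<beta> \<nu> / V + z\<^sup>2) * exp (- z\<^sup>2 / 2))
      = 1 - gauss_ratio ?x" by (rule sym)
  have "EdK_dnu V \<alpha> \<beta> \<nu> = 1 / (2 * \<nu> * (\<nu> + 1)) * ((2 * \<alpha> + 1) * (1 - gauss_ratio ?x) - 1)"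
    unfolding EdK_dnu_def I[symmetric] by simp
  also have "(2 * \<alpha> + 1) * (1 - gauss_ratio ?x) - 1
      = 2 * - ((\<alpha> + 1/2) * gauss_ratio ?x - \<alpha>)"
    by (simp add: algebra_simps)
  also have "1 / (2 * \<nu> * (\<nu> + 1)) * (2 * y) = y / (\<nu> * (\<nu> + 1))" for y
    by simp
  finally show ?thesis .
qed

text \<open>
  The description of \<open>A \<alpha>\<close> is proper: after clearing denominators the equation for \<open>x = \<alpha> - a\<close>
  is \<open>gauss_ratio x = \<alpha> / (\<alpha> + 1/2)\<close>.  The right side lies strictly between \<open>0\<close> and \<open>1\<close>, so a
  solution exists, and monotonicity makes it unique.
\<close>

lemma gauss_ratio_at_A:
  assumes "\<alpha> > 0"
  shows "\<alpha> - A \<alpha> > 0" "(\<alpha> + 1/2) * gauss_ratio (\<alpha> - A \<alpha>) = \<alpha>"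
proof -
  have eq: "F x = \<alpha> / ((2 * \<alpha> + 1) * x) \<longleftrightarrow> (\<alpha> + 1/2) * gauss_ratio x = \<alpha>" if "x > 0" for x
  proof -
    have "F x = \<alpha> / ((2 * \<alpha> + 1) * x) \<longleftrightarrow> gauss_ratio x / (2 * x) = (\<alpha> / (\<alpha> + 1/2)) / (2 * x)"
    proof -
      have "(2 * \<alpha> + 1) * x = (\<alpha> + 1/2) * (2 * x)" by (simp add: algebra_simps)
      then have "\<alpha> / ((2 * \<alpha> + 1) * x) = (\<alpha> / (\<alpha> + 1/2)) / (2 * x)"
        by (simp only: divide_divide_eq_left)
      then show ?thesis by (simp only: F_eq_gauss_ratio[OF that])
    qed
    also have "\<dots> \<longleftrightarrow> gauss_ratio x = \<alpha> / (\<alpha> + 1/2)"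
      using that by (simp only: divide_cancel_right) simp
    also have "\<dots> \<longleftrightarrow> (\<alpha> + 1/2) * gauss_ratio x = \<alpha>"
      using assms by (simp add: eq_divide_eq mult.commute)
    finally show ?thesis .
  qed
  have "0 < \<alpha> / (\<alpha> + 1/2)" "\<alpha> / (\<alpha> + 1/2) < 1" using assms by auto
  then obtain x where x: "x > 0" "gauss_ratio x = \<alpha> / (\<alpha> + 1/2)"
    using gauss_ratio_attains by blast
  have x': "(\<alpha> + 1/2) * gauss_ratio x = \<alpha>" using x(2) assms by (simp add: field_simps)
  have "A \<alpha> = \<alpha> - x"
    unfolding A_def
  proof (rule the_equality)
    show "\<alpha> - x < \<alpha> \<and> F (\<alpha> - (\<alpha> - x)) = \<alpha> / ((2 * \<alpha> + 1) * (\<alpha> - (\<alpha> - x)))"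
      using eq[OF x(1)] x' x(1) by simp
    fix a assume a: "a < \<alpha> \<and> F (\<alpha> - a) = \<alpha> / ((2 * \<alpha> + 1) * (\<alpha> - a))"
    then have "(\<alpha> + 1/2) * gauss_ratio (\<alpha> - a) = (\<alpha> + 1/2) * gauss_ratio x"
      using eq[of "\<alpha> - a"] x' by simp
    then have "gauss_ratio (\<alpha> - a) = gauss_ratio x" using assms by simp
    then have "\<alpha> - a = x"
      using strict_mono_on_eqD[OF gauss_ratio_strict_mono] a x(1) by fastforce
    then show "a = \<alpha> - x" by simp
  qed
  then show "\<alpha> - A \<alpha> > 0" "(\<alpha> + 1/2) * gauss_ratio (\<alpha> - A \<alpha>) = \<alpha>"
    using x(1) x' by auto
qed

section \<open>Relaxation of the flow\<close>

lemma first_nonpos_time: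
  fixes f :: "real \<Rightarrow> real"
  assumes cont: "continuous_on {0..} f" and "f 0 > 0" and "t \<ge> 0" "f t \<le> 0"
  obtains T where "T > 0" "f T \<le> 0" "\<And>s. 0 \<le> s \<Longrightarrow> s < T \<Longrightarrow> f s > 0"
proof -
  let ?S = "{s \<in> {0..t}. f s \<le> 0}"
  have "continuous_on {0..t} f" using cont by (rule continuous_on_subset) auto
  then have "closed ({0..t} \<inter> f -` {..0})" by (rule continuous_closed_preimage) auto
  then have "compact ({0..t} \<inter> ({0..t} \<inter> f -` {..0}))"
    by (intro compact_Int_closed compact_Icc)
  moreover have "{0..t} \<inter> ({0..t} \<inter> f -` {..0}) = ?S" by auto
  moreover have "?S \<noteq> {}" using assms by auto
  ultimately obtain T where T: "T \<in> ?S" "\<And>s. s \<in> ?S \<Longrightarrow> T \<le> s"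
    using compact_attains_inf[of ?S] by auto
  have "T \<noteq> 0" using T(1) assms(2) by auto
  show ?thesis
  proof (rule that)
    show "T > 0" "f T \<le> 0" using T(1) \<open>T \<noteq> 0\<close> by auto
    show "f s > 0" if "0 \<le> s" "s < T" for s
      using that T(1) T(2)[of s] by (auto simp: not_le[symmetric])
  qed
qed

text \<open>
  The flow for an arbitrary increasing factor \<open>h\<close> with a zero at \<open>r\<close>, as a function of
  \<open>sigma \<beta> \<nu>\<close> itself, so that \<open>V\<close> is absorbed into \<open>h\<close> and \<open>r\<close>.  The differential equations are
  assumed only where \<open>\<beta>\<close> and \<open>\<nu>\<close> are positive, because the reduction of the original right-hand
  sides to this form rests on \<open>sigma \<beta> \<nu> > 0\<close>; that the solution never leaves the quadrant is
  proved below.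
\<close>

locale relaxing_flow =
  fixes h :: "real \<Rightarrow> real" and r :: real and \<beta> \<nu> :: "real \<Rightarrow> real"
  assumes h_mono: "strict_mono_on {0<..} h"
    and r_pos: "r > 0" and h_r: "h r = 0"
    and cont_beta: "continuous_on {0..} \<beta>" and cont_nu: "continuous_on {0..} \<nu>"
    and deriv_beta: "\<And>t. \<lbrakk>t > 0; \<beta> t > 0; \<nu> t > 0\<rbrakk>
      \<Longrightarrow> (\<beta> has_real_derivative - h (sigma (\<beta> t) (\<nu> t)) / \<beta> t) (at t)"
    and deriv_nu: "\<And>t. \<lbrakk>t > 0; \<beta> t > 0; \<nu> t > 0\<rbrakk>
      \<Longrightarrow> (\<nu> has_real_derivative h (sigma (\<beta> t) (\<nu> t)) / (\<nu> t * (\<nu> t + 1))) (at t)"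
    and init_beta: "\<beta> 0 > 0" and init_nu: "\<nu> 0 > 0"
begin

definition energy :: "real \<Rightarrow> real" where
  "energy t = (\<beta> t)\<^sup>2 / 2 + \<nu> t ^ 3 / 3 + (\<nu> t)\<^sup>2 / 2"

text \<open>
  Inside the quadrant this is the logarithm of \<open>sigma \<beta> \<nu> / r\<close>, written as a sum so that its
  derivative has one term per factor.  Measuring the deviation on the logarithmic scale makes a
  bound on its absolute value keep \<open>sigma \<beta> \<nu>\<close> away from \<open>0\<close> as well as from infinity.
\<close>

definition dev :: "real \<Rightarrow> real" where
  "dev t = ln (\<beta> t) + ln (\<nu> t + 1) - ln (\<nu> t) - ln r"

lemma dev_eq:
  assumes "\<beta> t > 0" "\<nu> t > 0"
  shows "dev t = ln (sigma (\<beta> t) (\<nu> t) / r)"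
  using assms r_pos by (simp add: dev_def sigma_def ln_mult ln_div)

lemma sigma_eq:
  assumes "\<beta> t > 0" "\<nu> t > 0"
  shows "sigma (\<beta> t) (\<nu> t) = r * exp (dev t)"
proof -
  have "sigma (\<beta> t) (\<nu> t) > 0" using assms by (simp add: sigma_def)
  then show ?thesis using r_pos dev_eq[OF assms] by simp
qed

lemma deriv_energy:
  assumes "t > 0" "\<beta> t > 0" "\<nu> t > 0"
  shows "(energy has_real_derivative 0) (at t)"
proof -
  let ?h = "h (sigma (\<beta> t) (\<nu> t))"
  have "(energy has_real_derivative
      \<beta> t * b + (\<nu> t)\<^sup>2 * n + \<nu> t * n) (at t)"
    if "(\<beta> has_real_derivative b) (at t)" "(\<nu> has_real_derivative n) (at t)" for b n
    unfolding energy_def[abs_def] using that by (auto intro!: derivative_eq_intros)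
  from this[OF deriv_beta[OF assms] deriv_nu[OF assms]]
  have "(energy has_real_derivative
      \<beta> t * (- ?h / \<beta> t) + ((\<nu> t)\<^sup>2 + \<nu> t) * (?h / (\<nu> t * (\<nu> t + 1)))) (at t)"
    by (simp only: distrib_right add.assoc)
  moreover have "(\<nu> t)\<^sup>2 + \<nu> t = \<nu> t * (\<nu> t + 1)"
    by (simp add: power2_eq_square distrib_left)
  moreover have "\<nu> t * (\<nu> t + 1) \<noteq> 0" using assms(3) by auto
  ultimately show ?thesis using assms(2) by simp
qed

lemma deriv_dev_sq:
  assumes "t > 0" "\<beta> t > 0" "\<nu> t > 0"
  shows "((\<lambda>t. (dev t)\<^sup>2) has_real_derivative
    - 2 * (dev t * h (r * exp (dev t))) * (1 / (\<beta> t)\<^sup>2 + 1 / (\<nu> t * (\<nu> t + 1))\<^sup>2)) (at t)"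
proof -
  let ?h = "h (sigma (\<beta> t) (\<nu> t))"
  have "(dev has_real_derivative b / \<beta> t + n / (\<nu> t + 1) - n / \<nu> t) (at t)"
    if "(\<beta> has_real_derivative b) (at t)" "(\<nu> has_real_derivative n) (at t)" for b n
    unfolding dev_def[abs_def] using assms that by (auto intro!: derivative_eq_intros)
  from this[OF deriv_beta[OF assms] deriv_nu[OF assms]]
  have "(dev has_real_derivative (- ?h / \<beta> t) / \<beta> t + (?h / (\<nu> t * (\<nu> t + 1))) / (\<nu> t + 1)
      - (?h / (\<nu> t * (\<nu> t + 1))) / \<nu> t) (at t)" .
  also have "(- ?h / \<beta> t) / \<beta> t + (?h / (\<nu> t * (\<nu> t + 1))) / (\<nu> t + 1) - (?h / (\<nu> t * (\<nu> t + 1))) / \<nu> t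
      = - ?h * (1 / (\<beta> t)\<^sup>2 + 1 / (\<nu> t * (\<nu> t + 1))\<^sup>2)"
  proof -
    have "c / (\<nu> t + 1) - c / \<nu> t = - c * (1 / (\<nu> t * (\<nu> t + 1)))" for c
      using assms(3) by (simp add: divide_simps) (simp add: algebra_simps)
    from this[of "?h / (\<nu> t * (\<nu> t + 1))"]
    show ?thesis by (simp add: power2_eq_square distrib_left)
  qed
  finally have "((\<lambda>t. (dev t)\<^sup>2) has_real_derivative
      2 * dev t * (- ?h * (1 / (\<beta> t)\<^sup>2 + 1 / (\<nu> t * (\<nu> t + 1))\<^sup>2))) (at t)"
    by (auto intro!: derivative_eq_intros)
  then show ?thesis using sigma_eq assms(2,3) by (simp add: mult.assoc)
qed

text \<open>
  Monotonicity alone makes the restoring effect uniform away from the equilibrium: at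
  logarithmic deviations beyond \<open>\<epsilon>\<close> the factor \<open>h\<close> is at least as large in absolute value as
  at \<open>\<epsilon>\<close> or \<open>- \<epsilon>\<close>.
\<close>

lemma restoring:
  assumes "\<epsilon> > 0"
  obtains \<delta> where "\<delta> > 0" "\<And>u. \<bar>u\<bar> \<ge> \<epsilon> \<Longrightarrow> u * h (r * exp u) \<ge> \<delta>"
proof -
  have mono: "h (r * exp u) < h (r * exp v)" if "u < v" for u v
    using strict_mono_onD[OF h_mono] that r_pos by auto
  define m where "m = min (h (r * exp \<epsilon>)) (- h (r * exp (- \<epsilon>)))"
  have m: "m > 0" using mono[of 0 \<epsilon>] mono[of "-\<epsilon>" 0] assms h_r by (simp add: m_def)
  show ?thesis
  proof (rule that[of "\<epsilon> * m"])
    show "\<epsilon> * m > 0" using m assms by simp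
    fix u :: real assume "\<bar>u\<bar> \<ge> \<epsilon>"
    then consider "u \<ge> \<epsilon>" | "u \<le> - \<epsilon>" by linarith
    then show "\<epsilon> * m \<le> u * h (r * exp u)"
    proof cases
      case 1
      then have "m \<le> h (r * exp u)" using mono[of \<epsilon> u] by (cases "u = \<epsilon>") (auto simp: m_def)
      then show ?thesis using 1 assms m by (intro mult_mono) auto
    next
      case 2
      then have "m \<le> - h (r * exp u)" using mono[of u "-\<epsilon>"] by (cases "u = -\<epsilon>") (auto simp: m_def)
      then have "\<epsilon> * m \<le> (- u) * (- h (r * exp u))" using 2 assms m by (intro mult_mono) auto
      then show ?thesis by simp
    qed
  qed
qed

lemma restoring_nonneg: "u * h (r * exp u) \<ge> 0"
proof (cases "u = 0")
  case False
  then have "\<bar>u\<bar> > 0" by simp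
  from restoring[OF this] show ?thesis by (metis less_imp_le order_refl order_trans)
qed simp

lemma continuous_energy: "continuous_on {0..} energy"
  unfolding energy_def[abs_def] by (intro continuous_intros cont_beta cont_nu) auto

lemma continuous_dev:
  assumes "\<And>s. s \<in> {a..b} \<Longrightarrow> \<beta> s > 0" "\<And>s. s \<in> {a..b} \<Longrightarrow> \<nu> s > 0" "a \<ge> 0"
  shows "continuous_on {a..b} dev"
proof -
  have "continuous_on {a..b} \<beta>" "continuous_on {a..b} \<nu>"
    using cont_beta cont_nu assms(3) by (auto elim!: continuous_on_subset)
  then show ?thesis unfolding dev_def[abs_def]
    using assms(1,2) by (intro continuous_intros) (metis add_pos_pos less_irrefl zero_less_one)+
qed

lemma energy_const:
  assumes "t \<ge> 0" "\<And>s. 0 < s \<Longrightarrow> s < t \<Longrightarrow> \<beta> s > 0 \<and> \<nu> s > 0"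
  shows "energy t = energy 0"
proof (cases "t = 0")
  case False
  show ?thesis
  proof (rule DERIV_isconst_end[where f = energy])
    show "0 < t" using False assms(1) by simp
    show "continuous_on {0..t} energy"
      by (rule continuous_on_subset[OF continuous_energy]) auto
  qed (use assms deriv_energy in auto)
qed simp

text \<open>
  Of the two terms in \<open>1 / \<beta>\<^sup>2 + 1 / (\<nu> * (\<nu> + 1))\<^sup>2\<close> the first is enough for a rate, and it is
  the one that the energy bounds from below.
\<close>

lemma dev_sq_decreasing:
  assumes "0 \<le> a" "a \<le> b" and pos: "\<And>s. a \<le> s \<Longrightarrow> s \<le> b \<Longrightarrow> \<beta> s > 0 \<and> \<nu> s > 0"
    and rate: "\<And>s. a < s \<Longrightarrow> s < b \<Longrightarrow> k \<le> 2 * (dev s * h (r * exp (dev s))) / (\<beta> s)\<^sup>2"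
  shows "(dev b)\<^sup>2 \<le> (dev a)\<^sup>2 - k * (b - a)"
proof (cases "a = b")
  case False
  have "(dev b)\<^sup>2 + k * b \<le> (dev a)\<^sup>2 + k * a"
  proof (rule DERIV_nonpos_imp_decreasing_open[where f = "\<lambda>s. (dev s)\<^sup>2 + k * s"])
    show "a \<le> b" by fact
    show "continuous_on {a..b} (\<lambda>s. (dev s)\<^sup>2 + k * s)"
      using pos assms(1) by (intro continuous_intros continuous_dev) auto
    fix s assume s: "a < s" "s < b"
    let ?p = "dev s * h (r * exp (dev s))"
    have "- 2 * ?p * (1 / (\<beta> s)\<^sup>2 + 1 / (\<nu> s * (\<nu> s + 1))\<^sup>2) + k
        = (k - 2 * ?p / (\<beta> s)\<^sup>2) - 2 * ?p / (\<nu> s * (\<nu> s + 1))\<^sup>2"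
      by (simp add: algebra_simps)
    also have "\<dots> \<le> 0"
    proof -
      have "0 \<le> 2 * ?p / (\<nu> s * (\<nu> s + 1))\<^sup>2"
        using restoring_nonneg[of "dev s"] by (intro divide_nonneg_nonneg) auto
      then show ?thesis using rate[OF s] by linarith
    qed
    finally have "- 2 * ?p * (1 / (\<beta> s)\<^sup>2 + 1 / (\<nu> s * (\<nu> s + 1))\<^sup>2) + k \<le> 0" .
    moreover have "((\<lambda>s. (dev s)\<^sup>2 + k * s) has_real_derivative
        - 2 * ?p * (1 / (\<beta> s)\<^sup>2 + 1 / (\<nu> s * (\<nu> s + 1))\<^sup>2) + k) (at s)"
      by (rule DERIV_add[OF deriv_dev_sq DERIV_cmult_Id]) (use s assms(1) pos[of s] in auto)
    ultimately show "\<exists>y. ((\<lambda>s. (dev s)\<^sup>2 + k * s) has_real_derivative y) (at s) \<and> y \<le> 0"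
      by blast
  qed
  then show ?thesis by (simp add: algebra_simps)
qed simp

lemma dev_sq_antimono:
  assumes "0 \<le> a" "a \<le> b" "\<And>s. a \<le> s \<Longrightarrow> s \<le> b \<Longrightarrow> \<beta> s > 0 \<and> \<nu> s > 0"
  shows "(dev b)\<^sup>2 \<le> (dev a)\<^sup>2"
  using dev_sq_decreasing[OF assms, of 0] restoring_nonneg by simp

lemma energy_0_pos: "energy 0 > 0"
  using init_beta init_nu unfolding energy_def by (intro add_pos_pos) auto

text \<open>
  Up to the first time \<open>T\<close> at which a coordinate fails to be positive, the deviation is bounded by
  its initial value, which gives linear bounds between \<open>\<nu>\<close> and \<open>\<beta> * (\<nu> + 1)\<close>.  These are
  free of denominators and so pass to the limit at \<open>T\<close>, where they make both coordinates vanish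
  together, against conservation of the energy.
\<close>

lemma positive:
  assumes "t \<ge> 0"
  shows "\<beta> t > 0 \<and> \<nu> t > 0"
proof (rule ccontr)
  assume neg: "\<not> (\<beta> t > 0 \<and> \<nu> t > 0)"
  let ?f = "\<lambda>s. min (\<beta> s) (\<nu> s)"
  have "continuous_on {0..} ?f" by (intro continuous_intros cont_beta cont_nu)
  moreover have "?f 0 > 0" using init_beta init_nu by simp
  moreover have "?f t \<le> 0" using neg by auto
  ultimately obtain T where T: "T > 0" "?f T \<le> 0" and pos': "\<And>s. 0 \<le> s \<Longrightarrow> s < T \<Longrightarrow> ?f s > 0"
    using first_nonpos_time[of ?f t] assms by blast
  have pos: "\<beta> s > 0 \<and> \<nu> s > 0" if "0 \<le> s" "s < T" for s using pos'[OF that] by auto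
  define R where "R = \<bar>dev 0\<bar>"
  have bounds: "r * exp (- R) * \<nu> s \<le> \<beta> s * (\<nu> s + 1) \<and> \<beta> s * (\<nu> s + 1) \<le> r * exp R * \<nu> s \<and> 0 \<le> \<beta> s \<and> 0 \<le> \<nu> s"
    if s: "0 \<le> s" "s < T" for s
  proof -
    have "(dev s)\<^sup>2 \<le> (dev 0)\<^sup>2" using s pos by (intro dev_sq_antimono) auto
    then have "\<bar>dev s\<bar> \<le> R" by (simp add: R_def abs_le_square_iff)
    then have "exp (- R) \<le> exp (dev s)" "exp (dev s) \<le> exp R" by auto
    moreover have "\<beta> s * (\<nu> s + 1) = r * exp (dev s) * \<nu> s"
      using pos[OF s] by (simp add: sigma_eq[symmetric] sigma_def)
    ultimately show ?thesis using pos[OF s] r_pos by (auto intro!: mult_right_mono mult_left_mono)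
  qed
  have ev: "eventually (\<lambda>s. 0 \<le> s \<and> s < T) (at_left T)"
    using eventually_at_left_real[OF T(1)] by eventually_elim auto
  \<comment> \<open>\<open>\<beta>\<close> and \<open>\<nu>\<close> are assumed continuous only on \<open>{0..}\<close>, of which \<open>T > 0\<close> is an interior point\<close>
  have lim: "(\<beta> \<longlongrightarrow> \<beta> T) (at_left T)" "(\<nu> \<longlongrightarrow> \<nu> T) (at_left T)"
  proof -
    have "at T within {0..} = at T" using T(1) by (intro at_within_interior) (simp add: interior_real_atLeast)
    then have "(\<beta> \<longlongrightarrow> \<beta> T) (at T)" "(\<nu> \<longlongrightarrow> \<nu> T) (at T)"
      using cont_beta cont_nu T(1) by (auto simp: continuous_on_def dest!: bspec[of _ _ T])
    then show "(\<beta> \<longlongrightarrow> \<beta> T) (at_left T)" "(\<nu> \<longlongrightarrow> \<nu> T) (at_left T)"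
      by (auto simp: filterlim_at_split)
  qed
  have ev': "eventually (\<lambda>s. r * exp (- R) * \<nu> s \<le> \<beta> s * (\<nu> s + 1)
      \<and> \<beta> s * (\<nu> s + 1) \<le> r * exp R * \<nu> s \<and> 0 \<le> \<beta> s \<and> 0 \<le> \<nu> s) (at_left T)"
    using ev by eventually_elim (use bounds in blast)
  have nt: "at_left T \<noteq> bot" by (rule trivial_limit_at_left_real)
  have "0 \<le> \<beta> T"
    by (rule tendsto_le[OF nt lim(1) tendsto_const]) (use ev' in eventually_elim, blast)
  moreover have "0 \<le> \<nu> T"
    by (rule tendsto_le[OF nt lim(2) tendsto_const]) (use ev' in eventually_elim, blast)
  moreover have "r * exp (- R) * \<nu> T \<le> \<beta> T * (\<nu> T + 1)"
    by (rule tendsto_le[OF nt, where f = "\<lambda>s. \<beta> s * (\<nu> s + 1)" and g = "\<lambda>s. r * exp (- R) * \<nu> s"])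
       (intro tendsto_intros lim, intro tendsto_intros lim, use ev' in eventually_elim, blast)
  moreover have "\<beta> T * (\<nu> T + 1) \<le> r * exp R * \<nu> T"
    by (rule tendsto_le[OF nt, where g = "\<lambda>s. \<beta> s * (\<nu> s + 1)" and f = "\<lambda>s. r * exp R * \<nu> s"])
       (intro tendsto_intros lim, intro tendsto_intros lim, use ev' in eventually_elim, blast)
  ultimately have le: "0 \<le> \<beta> T" "0 \<le> \<nu> T" "r * exp (- R) * \<nu> T \<le> \<beta> T * (\<nu> T + 1)"
      "\<beta> T * (\<nu> T + 1) \<le> r * exp R * \<nu> T" by auto
  have "\<beta> T = 0 \<or> \<nu> T = 0" using T(2) le(1,2) by auto
  then have "\<beta> T = 0 \<and> \<nu> T = 0"
    using le r_pos by (auto simp: mult_le_0_iff)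
  then have "energy T = 0" by (simp add: energy_def)
  moreover have "energy T = energy 0" using T(1) pos by (intro energy_const) auto
  ultimately show False using energy_0_pos by simp
qed

lemma beta_sq_le:
  assumes "t \<ge> 0"
  shows "(\<beta> t)\<^sup>2 \<le> 2 * energy 0"
proof -
  have "energy 0 = energy t" using energy_const[of t] positive assms by simp
  moreover have "\<nu> t ^ 3 \<ge> 0" "(\<nu> t)\<^sup>2 \<ge> 0" using positive[OF assms] by auto
  ultimately show ?thesis unfolding energy_def[of t] by linarith
qed

text \<open>
  If the deviation never got below \<open>\<epsilon>\<close>, its square would decrease at a rate of at least \<open>k > 0\<close>
  and become negative.  Once it is below \<open>\<epsilon>\<close>, monotonicity keeps it there.
\<close>

lemma dev_tendsto_0: "(dev \<longlongrightarrow> 0) at_top"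
proof (rule tendstoI)
  fix \<epsilon> :: real assume e: "\<epsilon> > 0"
  then obtain \<delta> where d: "\<delta> > 0" "\<And>u. \<bar>u\<bar> \<ge> \<epsilon> \<Longrightarrow> u * h (r * exp u) \<ge> \<delta>"
    using restoring by blast
  define k where "k = \<delta> / energy 0"
  have k: "k > 0" using d(1) energy_0_pos by (simp add: k_def)
  \<comment> \<open>at this time the bound \<open>(dev 0)\<^sup>2 - k * t\<close> equals \<open>- 1\<close>\<close>
  define t where "t = ((dev 0)\<^sup>2 + 1) / k"
  have t: "t \<ge> 0" using k by (simp add: t_def)
  have "\<exists>s\<ge>0. \<bar>dev s\<bar> < \<epsilon>"
  proof (rule ccontr)
    assume "\<not> (\<exists>s\<ge>0. \<bar>dev s\<bar> < \<epsilon>)"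
    then have far: "\<bar>dev s\<bar> \<ge> \<epsilon>" if "s \<ge> 0" for s using that by force
    have "(dev t)\<^sup>2 \<le> (dev 0)\<^sup>2 - k * (t - 0)"
    proof (rule dev_sq_decreasing)
      fix s :: real assume s: "0 < s" "s < t"
      have "k = 2 * \<delta> / (2 * energy 0)" by (simp add: k_def)
      also have "\<dots> \<le> 2 * (dev s * h (r * exp (dev s))) / (\<beta> s)\<^sup>2"
        using d(2)[OF far[of s]] restoring_nonneg[of "dev s"] beta_sq_le[of s] positive[of s] s
        by (intro frac_le) auto
      finally show "k \<le> 2 * (dev s * h (r * exp (dev s))) / (\<beta> s)\<^sup>2" .
    qed (use t positive in auto)
    also have "\<dots> = -1" using k by (simp add: t_def)
    finally show False using zero_le_power2[of "dev t"] by linarith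
  qed
  then obtain s where s: "s \<ge> 0" "\<bar>dev s\<bar> < \<epsilon>" by blast
  have "\<bar>dev u\<bar> < \<epsilon>" if "u \<ge> s" for u
  proof -
    have "(dev u)\<^sup>2 \<le> (dev s)\<^sup>2" using s(1) that positive by (intro dev_sq_antimono) auto
    then show ?thesis using s(2) by (simp add: abs_le_square_iff[symmetric])
  qed
  then show "eventually (\<lambda>t. dist (dev t) 0 < \<epsilon>) at_top"
    by (auto simp: eventually_at_top_linorder)
qed

theorem sigma_tendsto: "((\<lambda>t. sigma (\<beta> t) (\<nu> t)) \<longlongrightarrow> r) at_top"
proof -
  have "((\<lambda>t. r * exp (dev t)) \<longlongrightarrow> r * exp 0) at_top"
    by (intro tendsto_intros dev_tendsto_0)
  moreover have "eventually (\<lambda>t. r * exp (dev t) = sigma (\<beta> t) (\<nu> t)) at_top"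
    using eventually_ge_at_top[of 0] by eventually_elim (use positive sigma_eq in auto)
  ultimately show ?thesis by (simp add: tendsto_cong)
qed

end

section \<open>Convergence of the variance estimate\<close>

theorem corollary4p1:
  fixes V \<alpha> :: real and \<beta> \<nu> :: "real \<Rightarrow> real"
  assumes "V > 0" and "\<alpha> > 0"
    and "flow_solution V \<alpha> \<beta> \<nu>"
    and "\<beta> 0 > 0" and "\<nu> 0 > 0"
  shows "((\<lambda>t. V_est \<alpha> (\<beta> t) (\<nu> t)) \<longlongrightarrow> V) at_top"
proof -
  define x where "x = \<alpha> - A \<alpha>"
  define h where "h = (\<lambda>s. (\<alpha> + 1/2) * gauss_ratio (s / V) - \<alpha>)"
  have x: "x > 0" "(\<alpha> + 1/2) * gauss_ratio x = \<alpha>"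
    using gauss_ratio_at_A[OF assms(2)] by (auto simp: x_def)
  have deriv: "(\<beta> has_real_derivative - EdK_dbeta V \<alpha> (\<beta> t) (\<nu> t)) (at t within {0..})"
    "(\<nu> has_real_derivative - EdK_dnu V \<alpha> (\<beta> t) (\<nu> t)) (at t within {0..})" if "t \<ge> 0" for t
    using assms(3) that by (auto simp: flow_solution_def)
  have at: "at t within {0..} = at t" if "t > 0" for t :: real
    using that by (intro at_within_interior) (simp add: interior_real_atLeast)
  interpret relaxing_flow h "V * x" \<beta> \<nu>
  proof
    show "strict_mono_on {0<..} h"
      unfolding h_def using assms(1,2)
      by (auto intro!: strict_mono_onI strict_mono_onD[OF gauss_ratio_strict_mono] divide_strict_right_mono)
    show "V * x > 0" "h (V * x) = 0" using assms(1) x by (auto simp: h_def)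
    show "continuous_on {0..} \<beta>" "continuous_on {0..} \<nu>"
      using deriv by (auto intro!: DERIV_continuous_on)
    fix t assume t: "t > 0" "\<beta> t > 0" "\<nu> t > 0"
    then have s: "sigma (\<beta> t) (\<nu> t) > 0" by (simp add: sigma_def)
    show "(\<beta> has_real_derivative - h (sigma (\<beta> t) (\<nu> t)) / \<beta> t) (at t)"
      using deriv(1)[of t] t(1) unfolding at[OF t(1)] EdK_dbeta_eq[OF assms(1) s] h_def
      by (simp only: minus_divide_left less_imp_le)
    show "(\<nu> has_real_derivative h (sigma (\<beta> t) (\<nu> t)) / (\<nu> t * (\<nu> t + 1))) (at t)"
      using deriv(2)[of t] t(1) unfolding at[OF t(1)] EdK_dnu_eq[OF assms(1) s] h_def
      by (simp only: minus_divide_left minus_minus less_imp_le)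
  qed (use assms in auto)
  have "((\<lambda>t. sigma (\<beta> t) (\<nu> t) / x) \<longlongrightarrow> V * x / x) at_top"
    using x(1) by (intro tendsto_intros sigma_tendsto) auto
  then show ?thesis
    using x(1) by (simp add: V_est_def sigma_def x_def mult.commute)
qed

end
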